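(* Let $G=(V,E)$ be a digraph, $\bar s\in\mathbb{Z}_+$, $S=\{1,\dots,\bar s\}$, and $D$ a set of demands, and let $RSA(G,D,\bar s)$ be the polytope described in the context. Let $j\in V$ be such that $j\notin\{s(d),t(d)\}$ for every $d\in D$. Let $\sum_{d\in D}\sum_{e\in E}\sum_{s\in S}a_{des}u_{des}\le b$ be a valid inequality (resp., an optimality cut) for $RSA(G,D,\bar s)$ such that for every $d\in D$ and every $s\in S$ there exist $\alpha_{ds},\beta_{ds}\in\mathbb{R}$ with $a_{des}=\alpha_{ds}$ for every $e\in\delta^+(j)$ and $a_{des}=\beta_{ds}$ for every $e\in\delta^-(j)$. Then the inequality $$\sum_{s\in S}\sum_{d\in D}\Big(\sum_{e\in\delta^-(j)}\alpha_{ds}u_{des}+\sum_{e\in\delta^+(j)}\beta_{ds}u_{des}+\sum_{e\in E\setminus\delta(j)}a_{des}u_{des}\Big)\le b$$ is also valid (resp., an optimality cut) for $RSA(G,D,\bar s)$.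
   Context: Routing and spectrum allocation (RSA) setting: $G=(V,E)$ is a digraph, $\bar s\in\mathbb{Z}_+$ is the number of available slots, $S=\{1,\dots,\bar s\}$, and $D$ is a finite set of demands, each $d\in D$ being a triple $(s(d),t(d),v(d))$ with source $s(d)\in V$, target $t(d)\in V$ and volume $v(d)\in\mathbb{Z}_+$. For $j\in V$, $\delta^-(j)$ and $\delta^+(j)$ denote the sets of incoming and outgoing arcs of $j$, and $\delta(j)=\delta^-(j)\cup\delta^+(j)$. There is a binary variable $u_{des}$ for each $d\in D$, $e\in E$, $s\in S$ (meaning demand $d$ uses slot $s$ on arc $e$), together with fictitious variables $u_{de,\bar s+1}$ fixed to $0$. The DSL-BF formulation is: minimize $\sum_{d\in D}\sum_{e\in E}\sum_{s\in S}u_{des}/v(d)$ subject to (i) $\sum_{e\in\delta^-(j)}u_{des}-\sum_{e\in\delta^+(j)}u_{des}=0$ for all $d\in D$, $j\in V\setminus\{s(d),t(d)\}$, $s\in S$; (ii) $\sum_{e\in\delta^+(s(d))}\sum_{s\in S}u_{des}\ge v(d)$ for all $d\in D$; (iii) $\sum_{e\in\delta^-(s(d))}\sum_{s\in S}u_{des}=0$ for all $d\in D$; (iv) $\sum_{d\in D}u_{des}\le 1$ for all $e\in E$, $s\in S$; (v) $v(d)(u_{des}-u_{de,s+1})\le\sum_{s'=f}^{s}u_{des'}$ for all $d\in D$, $e\in E$, $s\in S$, where $f=\max\{1,s-v(d)+1\}$; (vi) $u_{des}\in\{0,1\}$ for all $d,e,s$. $RSA(G,D,\bar s)$ is the convex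 hull of the feasible solutions of (i)–(vi). A valid inequality is a linear inequality in $u$ satisfied by all points of $RSA(G,D,\bar s)$. An optimality cut is a linear inequality that is not valid but does not remove all optimal solutions of the DSL-BF formulation (i.e., some optimal solution satisfies it). *)

theory Defs
  imports "HOL-Analysis.Analysis" "HOL-Analysis.Finite_Function_Topology" "Graph_Theory.Digraph"
begin

text \<open>
  The record is extensible, so a set of type \<open>('v, 'x) demand_scheme set\<close> covers both sets of plain
  triples and families in which several demands share the same source, target and volume
  (told apart by the extra data of type \<open>'x\<close>).
\<close>

record 'v demand =
  source :: 'v
  target :: 'v
  volume :: nat

text \<open>
  Digraphs are finite and have no loops, parallel arcs are allowed.  Without loops the sets of
  incoming and outgoing arcs of a vertex are disjoint.  Volumes are positive, since the
  objective function divides by them.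
\<close>

locale rsa_instance = fin_digraph G + loopfree_digraph G
  for G :: "('v, 'e) pre_digraph" (structure) +
  fixes D :: "('v, 'x) demand_scheme set"
  assumes finite_demands: "finite D"
    and source_in_verts: "d \<in> D \<Longrightarrow> source d \<in> verts G"
    and target_in_verts: "d \<in> D \<Longrightarrow> target d \<in> verts G"
    and volume_pos: "d \<in> D \<Longrightarrow> volume d > 0"

text \<open>
  The space of the variables \<open>u d e s\<close>.  Finitely supported functions form a real vector space in
  the library, so that \<open>convex hull\<close> and \<open>linear\<close> apply; feasible points are required below
  to vanish outside the index set, which also fixes the fictitious variables of slot
  \<open>sbar + 1\<close> to 0.
\<close>

type_synonym ('v, 'e, 'x) point = "(('v, 'x) demand_scheme \<times> 'e \<times> nat) \<Rightarrow>\<^sub>0 real"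

abbreviation var :: "('v, 'e, 'x) point \<Rightarrow> ('v, 'x) demand_scheme \<Rightarrow> 'e \<Rightarrow> nat \<Rightarrow> real" where
  "var u d e s \<equiv> Poly_Mapping.lookup u (d, e, s)"

definition slots :: "nat \<Rightarrow> nat set" where
  "slots sbar = {1..sbar}"

text \<open>
  In the last but one constraint \<open>s + 1 - volume d\<close> is truncated subtraction, which is harmless
  under the maximum with 1.
\<close>

definition dsl_bf_feasible ::
  "('v, 'e) pre_digraph \<Rightarrow> ('v, 'x) demand_scheme set \<Rightarrow> nat \<Rightarrow> ('v, 'e, 'x) point \<Rightarrow> bool" where
  "dsl_bf_feasible G D sbar u \<longleftrightarrow>
     Poly_Mapping.keys u \<subseteq> D \<times> arcs G \<times> slots sbar \<and>
     (\<forall>d\<in>D. \<forall>j\<in>verts G - {source d, target d}. \<forall>s\<in>slots sbar.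
        (\<Sum>e\<in>in_arcs G j. var u d e s) - (\<Sum>e\<in>out_arcs G j. var u d e s) = 0) \<and>
     (\<forall>d\<in>D. (\<Sum>e\<in>out_arcs G (source d). \<Sum>s\<in>slots sbar. var u d e s) \<ge> real (volume d)) \<and>
     (\<forall>d\<in>D. (\<Sum>e\<in>in_arcs G (source d). \<Sum>s\<in>slots sbar. var u d e s) = 0) \<and>
     (\<forall>e\<in>arcs G. \<forall>s\<in>slots sbar. (\<Sum>d\<in>D. var u d e s) \<le> 1) \<and>
     (\<forall>d\<in>D. \<forall>e\<in>arcs G. \<forall>s\<in>slots sbar.
        real (volume d) * (var u d e s - var u d e (s + 1))
          \<le> (\<Sum>s'\<in>{max 1 (s + 1 - volume d)..s}. var u d e s')) \<and>
     (\<forall>d\<in>D. \<forall>e\<in>arcs G. \<forall>s\<in>slots sbar. var u d e s \<in> {0, 1})"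

definition dsl_bf_objective ::
  "('v, 'e) pre_digraph \<Rightarrow> ('v, 'x) demand_scheme set \<Rightarrow> nat \<Rightarrow> ('v, 'e, 'x) point \<Rightarrow> real" where
  "dsl_bf_objective G D sbar u =
     (\<Sum>d\<in>D. \<Sum>e\<in>arcs G. \<Sum>s\<in>slots sbar. var u d e s / real (volume d))"

definition dsl_bf_optimal ::
  "('v, 'e) pre_digraph \<Rightarrow> ('v, 'x) demand_scheme set \<Rightarrow> nat \<Rightarrow> ('v, 'e, 'x) point \<Rightarrow> bool" where
  "dsl_bf_optimal G D sbar u \<longleftrightarrow>
     is_arg_min (dsl_bf_objective G D sbar) (dsl_bf_feasible G D sbar) u"

definition RSA ::
  "('v, 'e) pre_digraph \<Rightarrow> ('v, 'x) demand_scheme set \<Rightarrow> nat \<Rightarrow> ('v, 'e, 'x) point set" where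
  "RSA G D sbar = convex hull {u. dsl_bf_feasible G D sbar u}"

text \<open>
  The linear inequality \<open>f u \<le> b\<close> is represented by the linear functional \<open>f\<close> and the
  right-hand side \<open>b\<close>.
\<close>

definition valid_inequality ::
  "('v, 'e) pre_digraph \<Rightarrow> ('v, 'x) demand_scheme set \<Rightarrow> nat \<Rightarrow>
    (('v, 'e, 'x) point \<Rightarrow> real) \<Rightarrow> real \<Rightarrow> bool" where
  "valid_inequality G D sbar f b \<longleftrightarrow> linear f \<and> (\<forall>u\<in>RSA G D sbar. f u \<le> b)"

definition optimality_cut ::
  "('v, 'e) pre_digraph \<Rightarrow> ('v, 'x) demand_scheme set \<Rightarrow> nat \<Rightarrow>
    (('v, 'e, 'x) point \<Rightarrow> real) \<Rightarrow> real \<Rightarrow> bool" where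
  "optimality_cut G D sbar f b \<longleftrightarrow>
     linear f \<and> \<not> valid_inequality G D sbar f b \<and>
     (\<exists>u. dsl_bf_optimal G D sbar u \<and> f u \<le> b)"

end

theory Submission
  imports Defs
begin

text \<open>
  Flow conservation at \<open>j\<close> says that the total over \<open>\<delta>\<^sup>-(j)\<close> of each \<open>u d \<cdot> s\<close> equals the total over
  \<open>\<delta>\<^sup>+(j)\<close>, so interchanging the coefficients \<open>\<alpha> d s\<close> and \<open>\<beta> d s\<close> does not change the left-hand
  side at feasible points.  Validity and being an optimality cut depend only on the values of the
  left-hand side there.
\<close>

lemma lookup_scaleR: "Poly_Mapping.lookup (r *\<^sub>R u) i = r *\<^sub>R Poly_Mapping.lookup u i"
proof -
  \<comment> \<open>\<open>*\<^sub>R\<close> on finitely supported functions is defined through the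
    abstraction map; \<open>lookup\<close> undoes that map only once the scaled function is known to
    have finite support.\<close>
  have "finite {i. r *\<^sub>R Poly_Mapping.lookup u i \<noteq> 0}"
    by (rule finite_subset[OF _ finite_lookup[of u]]) auto
  then show ?thesis
    by (simp add: scaleR_poly_mapping_def)
qed

lemma linear_lookup: "linear (\<lambda>u :: 'i \<Rightarrow>\<^sub>0 real. Poly_Mapping.lookup u i)"
  by (rule linearI) (simp_all add: lookup_add lookup_scaleR)

lemma linear_cmult_lookup: "linear (\<lambda>u :: 'i \<Rightarrow>\<^sub>0 real. c * Poly_Mapping.lookup u i)"
  using linear_compose_scale_right[OF linear_lookup, of c i] by simp

lemma valid_inequality_iff_feasible:
  assumes "linear f"
  shows "valid_inequality G D sbar f b \<longleftrightarrow> (\<forall>u. dsl_bf_feasible G D sbar u \<longrightarrow> f u \<le> b)"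
proof -
  have "convex (f -` {..b})"
    using assms by (rule convex_linear_vimage) simp
  then have "{u. dsl_bf_feasible G D sbar u} \<subseteq> f -` {..b} \<longleftrightarrow> RSA G D sbar \<subseteq> f -` {..b}"
    unfolding RSA_def by (simp add: subset_hull)
  then show ?thesis
    using assms by (auto simp: valid_inequality_def)
qed

lemma valid_inequality_cong:
  assumes "linear f" "linear g"
    and "\<And>u. dsl_bf_feasible G D sbar u \<Longrightarrow> f u = g u"
  shows "valid_inequality G D sbar f b \<longleftrightarrow> valid_inequality G D sbar g b"
  using assms by (simp add: valid_inequality_iff_feasible)

text \<open>Failure of validity transfers by the previous congruence. An optimal solution is itself
  feasible, so the same witness serves for both functionals.\<close>

lemma optimality_cut_cong:
  assumes "linear f" "linear g"
    and "\<And>u. dsl_bf_feasible G D sbar u \<Longrightarrow> f u = g u"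
  shows "optimality_cut G D sbar f b \<longleftrightarrow> optimality_cut G D sbar g b"
  using assms valid_inequality_cong[OF assms]
  by (auto simp: optimality_cut_def dsl_bf_optimal_def is_arg_min_def)

lemma dsl_bf_feasible_flow:
  assumes "dsl_bf_feasible G D sbar u" "d \<in> D" "s \<in> slots sbar"
    and "j \<in> verts G" "j \<notin> {source d, target d}"
  shows "(\<Sum>e\<in>in_arcs G j. var u d e s) = (\<Sum>e\<in>out_arcs G j. var u d e s)"
proof -
  have "(\<Sum>e\<in>in_arcs G j. var u d e s) - (\<Sum>e\<in>out_arcs G j. var u d e s) = 0"
    using assms unfolding dsl_bf_feasible_def by blast
  then show ?thesis by simp
qed

text \<open>Disjointness keeps a loop at \<open>j\<close> from being counted twice.\<close>

lemma (in fin_digraph) sum_arcs_split_at: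
  assumes "in_arcs G j \<inter> out_arcs G j = {}"
  shows "(\<Sum>e\<in>arcs G. f e) = (\<Sum>e\<in>in_arcs G j. f e) + (\<Sum>e\<in>out_arcs G j. f e)
           + (\<Sum>e\<in>arcs G - (in_arcs G j \<union> out_arcs G j). f e)"
proof -
  have "in_arcs G j \<union> out_arcs G j \<subseteq> arcs G" by auto
  then have "sum f (arcs G) = sum f (arcs G - (in_arcs G j \<union> out_arcs G j))
      + sum f (in_arcs G j \<union> out_arcs G j)"
    by (rule sum.subset_diff) simp
  also have "sum f (in_arcs G j \<union> out_arcs G j) = sum f (in_arcs G j) + sum f (out_arcs G j)"
    using assms by (intro sum.union_disjoint finite_in_arcs finite_out_arcs)
  finally show ?thesis by (simp add: add.commute)
qed

text \<open>A common arc would have \<open>j\<close> as both head and tail, hence be a loop.\<close>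

lemma (in loopfree_digraph) in_arcs_out_arcs_disjoint: "in_arcs G j \<inter> out_arcs G j = {}"
  using no_loops by fastforce

theorem theorem2:
  fixes G :: "('v, 'e) pre_digraph"
    and D :: "('v, 'x) demand_scheme set"
    and sbar :: nat
    and j :: 'v
    and a :: "('v, 'x) demand_scheme \<Rightarrow> 'e \<Rightarrow> nat \<Rightarrow> real"
    and \<alpha> \<beta> :: "('v, 'x) demand_scheme \<Rightarrow> nat \<Rightarrow> real"
    and b :: real
  defines "old \<equiv> \<lambda>u :: ('v, 'e, 'x) point.
      \<Sum>d\<in>D. \<Sum>e\<in>arcs G. \<Sum>s\<in>slots sbar. a d e s * var u d e s"
    and "new \<equiv> \<lambda>u :: ('v, 'e, 'x) point.
      \<Sum>s\<in>slots sbar. \<Sum>d\<in>D.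
        (\<Sum>e\<in>in_arcs G j. \<alpha> d s * var u d e s)
        + (\<Sum>e\<in>out_arcs G j. \<beta> d s * var u d e s)
        + (\<Sum>e\<in>arcs G - (in_arcs G j \<union> out_arcs G j). a d e s * var u d e s)"
  assumes "rsa_instance G D"
    and "j \<in> verts G"
    and "\<And>d. d \<in> D \<Longrightarrow> j \<notin> {source d, target d}"
    and "\<And>d s e. d \<in> D \<Longrightarrow> s \<in> slots sbar \<Longrightarrow> e \<in> out_arcs G j \<Longrightarrow> a d e s = \<alpha> d s"
    and "\<And>d s e. d \<in> D \<Longrightarrow> s \<in> slots sbar \<Longrightarrow> e \<in> in_arcs G j \<Longrightarrow> a d e s = \<beta> d s"
  shows "(valid_inequality G D sbar old b \<longrightarrow> valid_inequality G D sbar new b) \<and>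
         (optimality_cut G D sbar old b \<longrightarrow> optimality_cut G D sbar new b)"
proof -
  interpret rsa_instance G D by fact
  have lin_old: "linear old"
    unfolding old_def by (intro linear_compose_sum ballI linear_cmult_lookup)
  have lin_new: "linear new"
    unfolding new_def by (intro linear_compose_sum ballI linear_compose_add linear_cmult_lookup)
  have eq: "old u = new u" if u: "dsl_bf_feasible G D sbar u" for u
  proof -
    \<comment> \<open>For fixed \<open>d\<close> and \<open>s\<close>, let x be the common value of
      inflow and outflow at \<open>j\<close>. The arcs at \<open>j\<close> contribute
      \<open>\<beta> d s\<close> * x + \<open>\<alpha> d s\<close> * x before the exchange and the
      same two terms in the other order after it.\<close>
    have swap: "(\<Sum>e\<in>arcs G. a d e s * var u d e s)
        = (\<Sum>e\<in>in_arcs G j. \<alpha> d s * var u d e s) + (\<Sum>e\<in>out_arcs G j. \<beta> d s * var u d e s)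
          + (\<Sum>e\<in>arcs G - (in_arcs G j \<union> out_arcs G j). a d e s * var u d e s)"
      if "d \<in> D" "s \<in> slots sbar" for d s
    proof -
      have "(\<Sum>e\<in>in_arcs G j. var u d e s) = (\<Sum>e\<in>out_arcs G j. var u d e s)"
        using u that assms(4) assms(5)[OF that(1)] by (rule dsl_bf_feasible_flow)
      moreover have "(\<Sum>e\<in>in_arcs G j. a d e s * var u d e s)
          = \<beta> d s * (\<Sum>e\<in>in_arcs G j. var u d e s)"
        using assms(7) that by (simp add: sum_distrib_left)
      moreover have "(\<Sum>e\<in>out_arcs G j. a d e s * var u d e s)
          = \<alpha> d s * (\<Sum>e\<in>out_arcs G j. var u d e s)"
        using assms(6) that by (simp add: sum_distrib_left)
      ultimately show ?thesis
        by (simp add: sum_arcs_split_at[OF in_arcs_out_arcs_disjoint[of j]] flip: sum_distrib_left)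
    qed
    \<comment> \<open>\<open>old\<close> sums over arcs before slots, \<open>new\<close> has slots
      outermost. Two interchanges move the arc sum innermost, where \<open>swap\<close>
      applies.\<close>
    have "old u = (\<Sum>d\<in>D. \<Sum>s\<in>slots sbar. \<Sum>e\<in>arcs G. a d e s * var u d e s)"
      unfolding old_def by (intro sum.cong refl sum.swap)
    also have "\<dots> = (\<Sum>s\<in>slots sbar. \<Sum>d\<in>D. \<Sum>e\<in>arcs G. a d e s * var u d e s)"
      by (rule sum.swap)
    also have "\<dots> = new u"
      unfolding new_def by (intro sum.cong refl swap)
    finally show ?thesis .
  qed
  show ?thesis
    using valid_inequality_cong[OF lin_old lin_new eq] optimality_cut_cong[OF lin_old lin_new eq]
    by blast
qed

end
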